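(* Let $N\ge 1$, $T>0$, and let $C=[c_{ij}]_{i,j=1}^N\colon\mathbb{R}\to\mathbb{R}^{N\times N}$ be a continuous, $T$-periodic matrix function such that for each $t\in\mathbb{R}$ all off-diagonal entries of $C(t)$ are positive, and such that the off-diagonal entries $c_{ij}$ ($i\neq j$) are independent of $t$. Let $\Lambda$ be the principal Lyapunov exponent of the linear system $\frac{du}{dt}=C(t)u$, and let $\overline{C}=[\overline{c}_{ij}]_{i,j=1}^N$ be the time average of $C$, i.e. $$\overline{c}_{ii}:=\frac1T\int_0^T c_{ii}(t)\,dt,\qquad \overline{c}_{ij}:=c_{ij}\ \text{ for } i\ne j.$$ Then $$\Lambda\ \ge\ \lambda_{\mathrm{dom}}(\overline{C}).$$
   Context: For a real $N\times N$ matrix $A$ with all off-diagonal entries positive, $\lambda_{\mathrm{dom}}(A)$ (the dominant eigenvalue) denotes the eigenvalue of $A$ with the largest real part; it is real and simple. For a continuous $T$-periodic matrix function $C\colon\mathbb{R}\to\mathbb{R}^{N\times N}$ let $U(t;s)$ denote the transition matrix of $\frac{du}{dt}=C(t)u$: $U(t;s)u_0$ is the value at time $t$ of the solution $u$ with $u(s)=u_0$. If all off-diagonal entries of $C(t)$ are positive for every $t$ (the system is then called strongly cooperative), the matrix $U(T;0)$ has all entries positive, and its spectral radius $\rho$ is a positive simple eigenvalue. The principal Lyapunov exponent of the system is $\Lambda:=\frac{\ln\rho}{T}$; it equals $\lim_{t\to\infty}\frac1t\ln\|U(t;0)\|$. *)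

theory Defs
  imports "HOL-Analysis.Analysis"
begin

text \<open>Eigenvalues of a real matrix are taken over the complex numbers.\<close>

definition eigenvalues :: "real^'n^'n \<Rightarrow> complex set" where
  "eigenvalues A =
     {l. \<exists>v :: complex^'n. v \<noteq> 0 \<and> map_matrix complex_of_real A *v v = l *s v}"

definition spectral_radius :: "real^'n^'n \<Rightarrow> real" where
  "spectral_radius A = Sup (cmod ` eigenvalues A)"

text \<open>The description below is proper when all off-diagonal entries of \<open>A\<close> are positive:
  the eigenvalue with the largest real part is then real (Perron--Frobenius).\<close>

definition dominant_eigenvalue :: "real^'n^'n \<Rightarrow> real" where
  "dominant_eigenvalue A =
     (THE l. complex_of_real l \<in> eigenvalues A \<and> (\<forall>m \<in> eigenvalues A. Re m \<le> l))"

text \<open>For continuous \<open>C\<close> the initial value problem has exactly one solution on the whole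
  real line, and its value at time \<open>t\<close> depends linearly on the initial value, so that
  \<open>transition_matrix C t s *v u0\<close> is \<open>ivp_solution C s u0 t\<close>.\<close>

definition ivp_solution ::
  "(real \<Rightarrow> real^'n^'n) \<Rightarrow> real \<Rightarrow> real^'n \<Rightarrow> real \<Rightarrow> real^'n" where
  "ivp_solution C s u0 =
     (THE u. (\<forall>t. (u has_vector_derivative C t *v u t) (at t)) \<and> u s = u0)"

definition transition_matrix :: "(real \<Rightarrow> real^'n^'n) \<Rightarrow> real \<Rightarrow> real \<Rightarrow> real^'n^'n" where
  "transition_matrix C t s = matrix (\<lambda>u0. ivp_solution C s u0 t)"

definition principal_lyapunov_exponent :: "(real \<Rightarrow> real^'n^'n) \<Rightarrow> real \<Rightarrow> real" where
  "principal_lyapunov_exponent C T = ln (spectral_radius (transition_matrix C T 0)) / T"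

text \<open>Time average of a \<open>T\<close>-periodic matrix function whose off-diagonal entries are
  constant in time; the latter are read off at time 0.\<close>

definition time_average :: "(real \<Rightarrow> real^'n^'n) \<Rightarrow> real \<Rightarrow> real^'n^'n" where
  "time_average C T =
     (\<chi> i j. if i = j then (1 / T) * integral {0..T} (\<lambda>t. C t $ i $ i) else C 0 $ i $ j)"

end

theory Submission
  imports Defs
begin

text \<open>The transition matrix \<open>U\<close> over one period is entrywise positive
  (\<open>transition_matrix_positive\<close>), so it has a positive eigenvector with an eigenvalue \<open>r > 0\<close>
  (\<open>perron_vector\<close>), and \<open>r\<close> is at most the spectral radius of \<open>U\<close> (\<open>le_spectral_radius\<close>). The solution \<open>u\<close> that
  starts at this eigenvector stays positive and satisfies \<open>u(T) = r u(0)\<close>.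

  Positivity permits taking logarithms. With \<open>w\<^sub>i = ln u\<^sub>i\<close>, dividing the equation for \<open>u\<^sub>i\<close> by \<open>u\<^sub>i\<close>,
  averaging over a period and using Jensen's inequality gives
  \<open>(ln r) / T \<ge> mean c\<^sub>i\<^sub>i + (\<Sum>j\<noteq>i. c\<^sub>i\<^sub>j exp (mean w\<^sub>j - mean w\<^sub>i))\<close>. In other words, the positive
  vector \<open>z\<close> with entries \<open>z\<^sub>i = exp (mean w\<^sub>i)\<close> satisfies \<open>A z \<le> (ln r / T) z\<close> entrywise, where \<open>A\<close> is the time
  average of \<open>C\<close> (\<open>averaged_log_supersolution\<close>). Finally, a matrix with nonnegative off-diagonal
  entries that satisfies \<open>A z \<le> L z\<close> for some positive \<open>z\<close> has no eigenvalue with real part above \<open>L\<close>: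
  this is Gershgorin's theorem with the entries of \<open>z\<close> as weights (\<open>weighted_gershgorin\<close>,
  \<open>dominant_eigenvalue_le\<close>).

  The transition matrix is defined by a unique description of solutions, so their existence on the
  whole real line, by the Picard series (\<open>solves_exists\<close>), and their uniqueness
  (\<open>solves_unique\<close>) have to be established before it says anything (\<open>transition_matrix_apply\<close>).\<close>

section \<open>Positive eigenvectors and eigenvalue bounds\<close>

lemma matrix_vector_mult_split_diagonal:
  fixes A :: "real^'n^'n"
  shows "(A *v x) $ i = A $ i $ i * x $ i + (\<Sum>j\<in>UNIV - {i}. A $ i $ j * x $ j)"
  by (simp add: matrix_vector_mult_def sum.remove[of UNIV i])

lemma real_eigenvalue:
  assumes "A *v x = r *s x" "x \<noteq> 0"
  shows "complex_of_real r \<in> eigenvalues A"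
proof -
  have "(map_matrix complex_of_real A *v (\<chi> i. complex_of_real (x $ i))) $ i =
      complex_of_real ((A *v x) $ i)" for i
    by (simp add: matrix_vector_mult_def map_matrix_def)
  then have "map_matrix complex_of_real A *v (\<chi> i. complex_of_real (x $ i)) =
      complex_of_real r *s (\<chi> i. complex_of_real (x $ i))"
    by (simp add: vec_eq_iff assms(1))
  moreover have "(\<chi> i. complex_of_real (x $ i)) \<noteq> 0"
    using assms(2) by (auto simp: vec_eq_iff)
  ultimately show ?thesis unfolding eigenvalues_def by blast
qed

text \<open>Let \<open>i\<close> maximise \<open>|v\<^sub>i| / z\<^sub>i\<close> over the entries of an eigenvector \<open>v\<close>. Row \<open>i\<close> of the
  eigenvalue equation puts \<open>m - a\<^sub>i\<^sub>i\<close> times \<open>v\<^sub>i\<close> against the off-diagonal entries, and replacing each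
  \<open>|v\<^sub>j|\<close> there by its bound \<open>z\<^sub>j |v\<^sub>i| / z\<^sub>i\<close> turns the off-diagonal sum into that of \<open>A z\<close>. This is
  Gershgorin's theorem for \<open>A\<close> conjugated by the diagonal matrix of \<open>z\<close>; keeping the disc rather
  than only a bound on the real part lets the same lemma also bound moduli.\<close>

lemma weighted_gershgorin:
  fixes A :: "real^'n^'n"
  assumes off: "\<And>i j. i \<noteq> j \<Longrightarrow> 0 \<le> A $ i $ j"
    and z: "\<And>i. 0 < z $ i" and Az: "\<And>i. (A *v z) $ i \<le> L * z $ i"
    and m: "m \<in> eigenvalues A"
  shows "\<exists>i. cmod (m - complex_of_real (A $ i $ i)) \<le> L - A $ i $ i"
proof -
  obtain v where v: "v \<noteq> 0" "map_matrix complex_of_real A *v v = m *s v"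
    using m by (auto simp: eigenvalues_def)
  have "Max (range (\<lambda>j. cmod (v $ j) / z $ j)) \<in> range (\<lambda>j. cmod (v $ j) / z $ j)"
    by (rule Max_in) auto
  then obtain i where "cmod (v $ i) / z $ i = Max (range (\<lambda>j. cmod (v $ j) / z $ j))"
    by (metis (lifting) rangeE)
  then have i: "\<And>j. cmod (v $ j) / z $ j \<le> cmod (v $ i) / z $ i"
    by simp
  define q where "q = cmod (v $ i) / z $ i"
  have vj: "cmod (v $ j) \<le> q * z $ j" for j
    using i[of j] z[of j] by (simp add: q_def pos_divide_le_eq)
  obtain j0 where "v $ j0 \<noteq> 0" using v(1) by (auto simp: vec_eq_iff)
  then have "0 < cmod (v $ j0) / z $ j0" using z by simp
  then have q: "0 < q" using i[of j0] by (simp add: q_def)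
  have "(\<Sum>j\<in>UNIV. complex_of_real (A $ i $ j) * v $ j) = m * v $ i"
    using v(2) by (simp add: vec_eq_iff matrix_vector_mult_def map_matrix_def)
  then have "(m - complex_of_real (A $ i $ i)) * v $ i =
      (\<Sum>j\<in>UNIV - {i}. complex_of_real (A $ i $ j) * v $ j)"
    by (simp add: sum.remove[of UNIV i] algebra_simps)
  then have "cmod (m - complex_of_real (A $ i $ i)) * cmod (v $ i) =
      cmod (\<Sum>j\<in>UNIV - {i}. complex_of_real (A $ i $ j) * v $ j)"
    by (metis norm_mult)
  also have "\<dots> \<le> (\<Sum>j\<in>UNIV - {i}. A $ i $ j * (q * z $ j))"
    using off vj by (intro sum_norm_le) (auto simp: norm_mult intro!: mult_mono)
  also have "\<dots> = q * ((A *v z) $ i - A $ i $ i * z $ i)"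
    by (simp add: matrix_vector_mult_def sum.remove[of UNIV i] sum_distrib_left algebra_simps)
  also have "\<dots> \<le> q * (L * z $ i - A $ i $ i * z $ i)"
    using Az[of i] q by (intro mult_left_mono) auto
  also have "\<dots> = (L - A $ i $ i) * cmod (v $ i)"
    using z[of i] by (simp add: q_def field_simps)
  finally have "cmod (m - complex_of_real (A $ i $ i)) * cmod (v $ i) \<le> (L - A $ i $ i) * cmod (v $ i)" .
  moreover have "0 < cmod (v $ i)" using q z[of i] by (simp add: q_def zero_less_divide_iff)
  ultimately show ?thesis by auto
qed

lemma Re_eigenvalue_le:
  fixes A :: "real^'n^'n"
  assumes "\<And>i j. i \<noteq> j \<Longrightarrow> 0 \<le> A $ i $ j"
    and "\<And>i. 0 < z $ i" and "\<And>i. (A *v z) $ i \<le> L * z $ i"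
    and "m \<in> eigenvalues A"
  shows "Re m \<le> L"
proof -
  obtain i where i: "cmod (m - complex_of_real (A $ i $ i)) \<le> L - A $ i $ i"
    using weighted_gershgorin[OF assms] by blast
  have "Re m - A $ i $ i \<le> cmod (m - complex_of_real (A $ i $ i))"
    using complex_Re_le_cmod[of "m - complex_of_real (A $ i $ i)"] by simp
  with i show ?thesis by simp
qed

text \<open>Nonnegative diagonal entries turn the disc bound into a bound \<open>|m| \<le> r\<close> for all eigenvalues \<open>m\<close>.
  The supremum defining the spectral radius is thus over a bounded set, and so it dominates the
  eigenvalue \<open>r\<close>.\<close>

lemma le_spectral_radius:
  fixes A :: "real^'n^'n"
  assumes A: "\<And>i j. 0 \<le> A $ i $ j"
    and x: "\<And>i. 0 < x $ i" and Ax: "A *v x = r *s x"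
  shows "r \<le> spectral_radius A"
proof -
  have "cmod m \<le> r" if m: "m \<in> eigenvalues A" for m
  proof -
    obtain i where i: "cmod (m - complex_of_real (A $ i $ i)) \<le> r - A $ i $ i"
      using weighted_gershgorin[of A x r m] A x Ax m by auto
    have "cmod m \<le> cmod (m - complex_of_real (A $ i $ i)) + cmod (complex_of_real (A $ i $ i))"
      by (metis diff_add_cancel norm_triangle_ineq)
    with i A show ?thesis by simp
  qed
  then have bdd: "bdd_above (cmod ` eigenvalues A)" by (intro bdd_aboveI[of _ r]) auto
  have "x \<noteq> 0" using x by (metis less_irrefl zero_index)
  then have "complex_of_real r \<in> eigenvalues A" using real_eigenvalue Ax by blast
  then have "cmod (complex_of_real r) \<le> spectral_radius A"
    unfolding spectral_radius_def by (intro cSUP_upper bdd)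
  then show ?thesis by simp
qed

text \<open>Normalising \<open>A x\<close> to coordinate sum 1 maps the standard simplex continuously into itself,
  because \<open>A x\<close> has positive entries for every \<open>x\<close> in the simplex. A Brouwer fixed point is an
  eigenvector, and it is positive because it is proportional to \<open>A x\<close>.\<close>

lemma perron_vector:
  fixes A :: "real^'n^'n"
  assumes A: "\<And>i j. 0 < A $ i $ j"
  obtains x r where "\<And>i. 0 < x $ i" "0 < r" "A *v x = r *s x"
proof -
  define S where "S = {x::real^'n. (\<forall>i. 0 \<le> x $ i) \<and> (\<Sum>i\<in>UNIV. x $ i) = 1}"
  define f where "f x = (1 / (\<Sum>i\<in>UNIV. (A *v x) $ i)) *\<^sub>R (A *v x)" for x
  have "bounded S"
    unfolding bounded_iff
  proof (intro exI ballI)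
    fix x assume "x \<in> S"
    then show "norm x \<le> 1" using norm_le_l1_cart[of x] by (simp add: S_def)
  qed
  moreover have "closed S"
    unfolding S_def
    by (intro closed_Collect_conj closed_Collect_all closed_Collect_le closed_Collect_eq continuous_intros)
  ultimately have "compact S" by (simp add: compact_eq_bounded_closed)
  have "convex S"
    unfolding convex_alt S_def
    by (auto simp: sum.distrib intro!: add_nonneg_nonneg simp flip: sum_distrib_left)
  have "axis i 1 \<in> S" for i by (auto simp: S_def axis_def)
  then have "S \<noteq> {}" by blast
  have Ax: "0 < (A *v x) $ i" if x: "x \<in> S" for x i
  proof -
    obtain j where "x $ j \<noteq> 0" using x by (force simp: S_def)
    then have "0 < x $ j" using x by (simp add: S_def less_le)
    then show ?thesis unfolding matrix_vector_mult_def vec_lambda_beta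
      using x A by (intro sum_pos2[of _ j]) (auto simp: S_def less_imp_le)
  qed
  have sum_Ax: "0 < (\<Sum>i\<in>UNIV. (A *v x) $ i)" if "x \<in> S" for x
    using Ax[OF that] by (intro sum_pos) auto
  have "continuous_on S f"
    unfolding f_def
    by (intro continuous_intros matrix_vector_mult_linear_continuous_on) (use sum_Ax in force)
  moreover have "f \<in> S \<rightarrow> S"
  proof
    fix x assume x: "x \<in> S"
    have "(\<Sum>i\<in>UNIV. f x $ i) = 1"
      using sum_Ax[OF x] by (simp add: f_def flip: sum_divide_distrib)
    then show "f x \<in> S" 
      using sum_Ax[OF x] Ax[OF x] by (auto simp: S_def f_def less_imp_le)
  qed
  ultimately obtain x where x: "x \<in> S" "f x = x"
    using brouwer \<open>compact S\<close> \<open>convex S\<close> \<open>S \<noteq> {}\<close> by metis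
  let ?r = "\<Sum>i\<in>UNIV. (A *v x) $ i"
  have r: "0 < ?r" using sum_Ax x(1) .
  have eq: "A *v x = ?r *s x"
  proof -
    have "?r *s x = ?r *\<^sub>R f x" using x(2) by (simp add: scalar_mult_eq_scaleR)
    also have "\<dots> = A *v x" using r by (simp add: f_def)
    finally show ?thesis by simp
  qed
  have "0 < x $ i" for i
  proof -
    have "(A *v x) $ i = ?r * x $ i"
      using arg_cong[OF eq, of "\<lambda>y. y $ i"] by (simp only: vector_smult_component)
    then have "0 < ?r * x $ i" using Ax[OF x(1), of i] by (simp only:)
    then show ?thesis using r by (metis zero_less_mult_pos)
  qed
  with r eq show ?thesis using that by blast
qed

text \<open>Adding a large multiple of the identity makes all entries of \<open>A\<close> positive without changing the
  eigenvectors, so \<open>A\<close> has a positive eigenvector \<open>x\<close>. Using \<open>x\<close> as weight shows that its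
  eigenvalue has the largest real part, which identifies the description in
  \<^const>\<open>dominant_eigenvalue\<close>; using \<open>z\<close> as weight bounds it by \<open>L\<close>.\<close>

lemma dominant_eigenvalue_le:
  fixes A :: "real^'n^'n"
  assumes off: "\<And>i j. i \<noteq> j \<Longrightarrow> 0 < A $ i $ j"
    and z: "\<And>i. 0 < z $ i" and Az: "\<And>i. (A *v z) $ i \<le> L * z $ i"
  shows "dominant_eigenvalue A \<le> L"
proof -
  define k where "k = 1 + (\<Sum>i\<in>UNIV. \<bar>A $ i $ i\<bar>)"
  have k: "0 < A $ i $ i + k" for i
    using member_le_sum[of i UNIV "\<lambda>i. \<bar>A $ i $ i\<bar>"] unfolding k_def by simp
  define B where "B = (\<chi> i j. A $ i $ j + (if i = j then k else 0))"
  have "0 < B $ i $ j" for i j using k off by (auto simp: B_def)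
  then obtain x r where x: "\<And>i. 0 < x $ i" and Bx: "B *v x = r *s x"
    using perron_vector by metis
  have "(B *v x) $ i = (A *v x) $ i + k * x $ i" for i
    by (simp add: B_def matrix_vector_mult_def distrib_right sum.distrib if_distrib[of "\<lambda>a. a * _"]
        cong: if_cong)
  then have Ax: "A *v x = (r - k) *s x"
    using Bx by (simp add: vec_eq_iff algebra_simps)
  have "x \<noteq> 0" using x by (metis less_irrefl zero_index)
  then have ev: "complex_of_real (r - k) \<in> eigenvalues A" using real_eigenvalue Ax by blast
  have max: "Re m \<le> r - k" if "m \<in> eigenvalues A" for m
  proof (rule Re_eigenvalue_le[OF less_imp_le[OF off] x _ that])
    show "(A *v x) $ i \<le> (r - k) * x $ i" for i by (simp add: Ax left_diff_distrib)
  qed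
  have "dominant_eigenvalue A = r - k"
    unfolding dominant_eigenvalue_def
    by (rule the_equality) (use ev max in \<open>force+\<close>)
  also have "\<dots> \<le> L"
    using Re_eigenvalue_le[OF less_imp_le[OF off] z Az ev] by simp
  finally show ?thesis .
qed

section \<open>Solutions of linear differential equations\<close>

definition solves :: "(real \<Rightarrow> real^'n^'n) \<Rightarrow> (real \<Rightarrow> real^'n) \<Rightarrow> bool" where
  "solves C u \<longleftrightarrow> (\<forall>t. (u has_vector_derivative C t *v u t) (at t))"

lemma norm_matrix_vector_mult_le:
  fixes A :: "real^'n^'m"
  shows "norm (A *v x) \<le> norm A * norm x * CARD('m)"
proof -
  have "norm (A *v x) \<le> (\<Sum>i\<in>UNIV. \<bar>(A *v x) $ i\<bar>)"
    by (rule norm_le_l1_cart)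
  also have "\<dots> \<le> (\<Sum>i\<in>(UNIV::'m set). norm A * norm x)"
  proof (rule sum_mono)
    fix i
    have "\<bar>(A *v x) $ i\<bar> \<le> norm (A $ i) * norm x"
      by (simp add: matrix_vector_mul_component Cauchy_Schwarz_ineq2)
    also have "\<dots> \<le> norm A * norm x"
      by (intro mult_right_mono Finite_Cartesian_Product.norm_nth_le) auto
    finally show "\<bar>(A *v x) $ i\<bar> \<le> norm A * norm x" .
  qed
  finally show ?thesis by (simp add: mult.commute)
qed

lemma bounded_bilinear_matrix_vector_mult:
  "bounded_bilinear ((*v) :: real^'n^'m \<Rightarrow> real^'n \<Rightarrow> real^'m)"
proof
  show "\<exists>K. \<forall>(A::real^'n^'m) x. norm (A *v x) \<le> norm A * norm x * K"
    using norm_matrix_vector_mult_le by blast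
qed (simp_all add: matrix_vector_mult_add_rdistrib matrix_vector_right_distrib
      scaleR_matrix_vector_assoc[symmetric] matrix_vector_mult_scaleR)

lemmas continuous_on_matrix_vector_mult =
  bounded_bilinear.continuous_on[OF bounded_bilinear_matrix_vector_mult]

lemma antiderivative_on_real_line:
  fixes f :: "real \<Rightarrow> 'a::euclidean_space"
  assumes "continuous_on UNIV f"
  shows "\<exists>F. F 0 = a \<and> (\<forall>t. (F has_vector_derivative f t) (at t))"
proof -
  have "\<exists>F. \<forall>x::real. -\<infinity> < ereal x \<longrightarrow> ereal x < \<infinity> \<longrightarrow> (F has_vector_derivative f x) (at x)"
    using assms by (intro einterval_antiderivative) (auto simp: continuous_on_eq_continuous_at)
  then obtain F where F: "\<And>x. (F has_vector_derivative f x) (at x)" by auto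
  have "((\<lambda>t. F t - F 0 + a) has_vector_derivative f t) (at t)" for t
    by (auto intro!: derivative_eq_intros F)
  then show ?thesis by (intro exI[of _ "\<lambda>t. F t - F 0 + a"]) auto
qed

text \<open>The induction step for the Picard terms: each integration gains a factor \<open>t / (n + 1)\<close>,
  which is the source of the factorial that makes the series converge.\<close>

lemma antiderivative_power_bound_nonneg:
  fixes F :: "real \<Rightarrow> 'a::real_normed_vector"
  assumes F: "\<And>s. (F has_vector_derivative f s) (at s)" "F 0 = 0"
    and f: "\<And>s. 0 \<le> s \<Longrightarrow> s \<le> t \<Longrightarrow> norm (f s) \<le> c * s ^ n"
    and "0 \<le> t"
  shows "norm (F t) \<le> c * t ^ Suc n / Suc n"
proof (cases "t = 0")
  case False
  have "norm (F t - F 0) \<le> c * t ^ Suc n / Suc n - c * 0 ^ Suc n / Suc n"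
  proof (rule differentiable_bound_general)
    show "continuous_on {0..t} F"
      using F(1) by (meson has_vector_derivative_continuous continuous_at_imp_continuous_on)
    show "((\<lambda>t. c * t ^ Suc n / Suc n) has_vector_derivative c * s ^ n) (at s)" for s
      unfolding has_real_derivative_iff_has_vector_derivative[symmetric]
      by (auto intro!: derivative_eq_intros simp del: power_Suc of_nat_Suc)
  qed (use assms False in \<open>auto intro!: continuous_intros\<close>)
  then show ?thesis using F(2) by simp
qed (use F(2) in simp)

lemma antiderivative_power_bound:
  fixes F :: "real \<Rightarrow> 'a::real_normed_vector"
  assumes F: "\<And>s. (F has_vector_derivative f s) (at s)" "F 0 = 0"
    and f: "\<And>s. \<bar>s\<bar> \<le> R \<Longrightarrow> norm (f s) \<le> c * \<bar>s\<bar> ^ n"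
    and t: "\<bar>t\<bar> \<le> R"
  shows "norm (F t) \<le> c * \<bar>t\<bar> ^ Suc n / Suc n"
proof (cases "0 \<le> t")
  case True
  show ?thesis
    using antiderivative_power_bound_nonneg[of F f t c n] f[of s for s] F t True
    by (metis (no_types, lifting) abs_of_nonneg order_trans)
next
  case False
  have "norm ((\<lambda>s. F (- s)) (- t)) \<le> c * (- t) ^ Suc n / Suc n"
  proof (rule antiderivative_power_bound_nonneg)
    show "((\<lambda>s. F (- s)) has_vector_derivative - f (- s)) (at s)" for s
    proof -
      have "(uminus has_vector_derivative - 1) (at s)"
        by (auto intro!: derivative_eq_intros)
      then show ?thesis
        using vector_diff_chain_at[of uminus "-1" s F "f (- s)"] F(1) by (simp add: o_def)
    qed
    show "norm (- f (- s)) \<le> c * s ^ n" if "0 \<le> s" "s \<le> - t" for s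
      using f[of "- s"] that t False by auto
  qed (use False F in auto)
  then show ?thesis using False by simp
qed

lemma matrix_fun_bounded:
  fixes C :: "real \<Rightarrow> real^'n^'n"
  assumes "continuous_on UNIV C"
  shows "\<exists>K\<ge>0. \<forall>t. \<bar>t\<bar> \<le> R \<longrightarrow> (\<forall>v. norm (C t *v v) \<le> K * norm v)"
proof -
  have "bounded (C ` {-R..R})"
    using assms by (intro compact_imp_bounded compact_continuous_image)
      (auto intro: continuous_on_subset)
  then obtain B where B: "\<And>t. t \<in> {-R..R} \<Longrightarrow> norm (C t) \<le> B" "B > 0"
    unfolding bounded_pos[of "C ` {-R..R}"] by (metis imageI)
  show ?thesis
  proof (intro exI[of _ "B * CARD('n)"] conjI allI impI)
    fix t :: real and v :: "real^'n" assume "\<bar>t\<bar> \<le> R"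
    then have "norm (C t) \<le> B" using B(1)[of t] by (auto simp: abs_le_iff)
    then have "norm (C t) * norm v * CARD('n) \<le> B * norm v * CARD('n)"
      by (intro mult_right_mono) auto
    with norm_matrix_vector_mult_le[of "C t" v]
    show "norm (C t *v v) \<le> B * CARD('n) * norm v" by (simp add: mult_ac)
  qed (use B in auto)
qed

text \<open>If the norm of \<open>C\<close> is at most \<open>K\<close> on the interval between \<open>-|t|\<close> and \<open>|t|\<close>, then
  \<open>e\<^bsup>-2Ks\<^esup> |w(s)|\<^sup>2\<close> decreases for \<open>s \<ge> 0\<close> and \<open>e\<^bsup>2Ks\<^esup> |w(s)|\<^sup>2\<close> increases for \<open>s \<le> 0\<close>; both
  vanish at 0.\<close>

lemma solves_unique_zero:
  assumes C: "continuous_on UNIV C" and w: "solves C w" "w 0 = 0"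
  shows "w t = 0"
proof -
  obtain K where K: "K \<ge> 0" "\<And>s v. \<bar>s\<bar> \<le> \<bar>t\<bar> \<Longrightarrow> norm (C s *v v) \<le> K * norm v"
    using matrix_fun_bounded[OF C] by metis
  have dw: "(w has_vector_derivative C s *v w s) (at s)" for s
    using w by (auto simp: solves_def)
  have inner: "\<bar>w s \<bullet> (C s *v w s)\<bar> \<le> K * (w s \<bullet> w s)" if "\<bar>s\<bar> \<le> \<bar>t\<bar>" for s
  proof -
    have "\<bar>w s \<bullet> (C s *v w s)\<bar> \<le> norm (w s) * norm (C s *v w s)"
      by (rule Cauchy_Schwarz_ineq2)
    also have "\<dots> \<le> norm (w s) * (K * norm (w s))"
      by (intro mult_left_mono K that) auto
    finally show ?thesis by (simp add: dot_square_norm power2_eq_square mult_ac)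
  qed
  have d: "((\<lambda>s. exp (k * s) * (w s \<bullet> w s)) has_real_derivative
      exp (k * s) * (k * (w s \<bullet> w s) + 2 * (w s \<bullet> (C s *v w s)))) (at s)" for k s
  proof -
    have "((\<lambda>s. w s \<bullet> w s) has_real_derivative 2 * (w s \<bullet> (C s *v w s))) (at s)"
      using bounded_bilinear.has_vector_derivative[OF bounded_bilinear_inner dw dw, of s]
      by (simp add: has_real_derivative_iff_has_vector_derivative inner_commute)
    then show ?thesis
      by (auto intro!: derivative_eq_intros simp: algebra_simps)
  qed
  have "w t \<bullet> w t \<le> 0"
  proof (cases "0 \<le> t")
    case True
    have "exp (- (2*K) * t) * (w t \<bullet> w t) \<le> exp (- (2*K) * 0) * (w 0 \<bullet> w 0)"
    proof (rule DERIV_nonpos_imp_nonincreasing[OF True])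
      fix s assume s: "0 \<le> s" "s \<le> t"
      then have "- (2*K) * (w s \<bullet> w s) + 2 * (w s \<bullet> (C s *v w s)) \<le> 0"
        using inner[of s] by auto
      then show "\<exists>y. ((\<lambda>s. exp (- (2*K) * s) * (w s \<bullet> w s)) has_real_derivative y) (at s) \<and> y \<le> 0"
        by (intro exI[of _ "exp (- (2*K) * s) * (- (2*K) * (w s \<bullet> w s) + 2 * (w s \<bullet> (C s *v w s)))"] conjI d
              mult_nonneg_nonpos) auto
    qed
    then show ?thesis using w(2) by (simp add: mult_le_0_iff)
  next
    case False
    have "exp ((2*K) * t) * (w t \<bullet> w t) \<le> exp ((2*K) * 0) * (w 0 \<bullet> w 0)"
    proof (rule DERIV_nonneg_imp_nondecreasing[where f = "\<lambda>s. exp ((2*K) * s) * (w s \<bullet> w s)"])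
      show "t \<le> 0" using False by simp
      fix s assume s: "t \<le> s" "s \<le> 0"
      then have "(2*K) * (w s \<bullet> w s) + 2 * (w s \<bullet> (C s *v w s)) \<ge> 0"
        using inner[of s] by auto
      then show "\<exists>y. ((\<lambda>s. exp ((2*K) * s) * (w s \<bullet> w s)) has_real_derivative y) (at s) \<and> y \<ge> 0"
        by (intro exI[of _ "exp ((2*K) * s) * ((2*K) * (w s \<bullet> w s) + 2 * (w s \<bullet> (C s *v w s)))"] conjI d
              mult_nonneg_nonneg) auto
    qed
    then show ?thesis using w(2) by (simp add: mult_le_0_iff)
  qed
  then show ?thesis using inner_ge_zero[of "w t"] by (simp add: antisym)
qed

lemma solves_lincomb:
  assumes "solves C u" "solves C v"
  shows "solves C (\<lambda>t. a *\<^sub>R u t + b *\<^sub>R v t)"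
  using assms unfolding solves_def
  by (auto intro!: derivative_eq_intros simp: matrix_vector_right_distrib matrix_vector_mult_scaleR)

lemma solves_unique:
  assumes "continuous_on UNIV C" "solves C u" "solves C v" "u 0 = v 0"
  shows "u = v"
proof
  fix t
  have "1 *\<^sub>R u t + (-1) *\<^sub>R v t = 0"
    using solves_unique_zero[OF assms(1) solves_lincomb[OF assms(2,3), of 1 "-1"]] assms(4) by simp
  then show "u t = v t" by simp
qed

text \<open>The difference of consecutive Picard iterates. The antiderivative is chosen by its defining
  property so that positive and negative times are covered by one formula.\<close>

primrec picard_term :: "(real \<Rightarrow> real^'n^'n) \<Rightarrow> real^'n \<Rightarrow> nat \<Rightarrow> real \<Rightarrow> real^'n" where
  "picard_term C x 0 = (\<lambda>t. x)"
| "picard_term C x (Suc n) =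
     (SOME F. F 0 = 0 \<and> (\<forall>t. (F has_vector_derivative C t *v picard_term C x n t) (at t)))"

lemma picard_term_Suc:
  assumes C: "continuous_on UNIV C"
  shows "picard_term C x (Suc n) 0 = 0"
    and "(picard_term C x (Suc n) has_vector_derivative C t *v picard_term C x n t) (at t)"
proof -
  have *: "continuous_on UNIV (picard_term C x n) \<Longrightarrow>
     picard_term C x (Suc n) 0 = 0 \<and> (\<forall>t. (picard_term C x (Suc n)
       has_vector_derivative C t *v picard_term C x n t) (at t))" for n
  proof -
    assume "continuous_on UNIV (picard_term C x n)"
    then have "\<exists>F. F 0 = 0 \<and> (\<forall>t. (F has_vector_derivative C t *v picard_term C x n t) (at t))"
      by (intro antiderivative_on_real_line continuous_on_matrix_vector_mult C)
    from someI_ex[OF this] show ?thesis by simp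
  qed
  have "continuous_on UNIV (picard_term C x n)" for n
  proof (induction n)
    case (Suc n)
    show ?case using *[OF Suc]
      by (meson has_vector_derivative_continuous continuous_at_imp_continuous_on)
  qed simp
  from *[OF this] show "picard_term C x (Suc n) 0 = 0"
    and "(picard_term C x (Suc n) has_vector_derivative C t *v picard_term C x n t) (at t)"
    by auto
qed

lemma picard_term_bound:
  assumes C: "continuous_on UNIV C" and K: "K \<ge> 0"
    "\<And>s v. \<bar>s\<bar> \<le> R \<Longrightarrow> norm (C s *v v) \<le> K * norm v" and t: "\<bar>t\<bar> \<le> R"
  shows "norm (picard_term C x n t) \<le> norm x * K ^ n / fact n * \<bar>t\<bar> ^ n"
  using t
proof (induction n arbitrary: t)
  case (Suc n)
  have "norm (picard_term C x (Suc n) t) \<le> (K * (norm x * K ^ n / fact n)) * \<bar>t\<bar> ^ Suc n / Suc n"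
  proof (rule antiderivative_power_bound)
    fix s assume s: "\<bar>s\<bar> \<le> R"
    have "norm (C s *v picard_term C x n s) \<le> K * norm (picard_term C x n s)"
      using K s by auto
    also have "\<dots> \<le> K * (norm x * K ^ n / fact n * \<bar>s\<bar> ^ n)"
      using Suc.IH[OF s] K(1) by (intro mult_left_mono) auto
    finally show "norm (C s *v picard_term C x n s) \<le> K * (norm x * K ^ n / fact n) * \<bar>s\<bar> ^ n"
      by (simp add: mult_ac)
  qed (use picard_term_Suc[OF C] Suc.prems in auto)
  then show ?case by (simp add: field_simps)
qed simp

text \<open>The bound \<open>|x| (K R)\<^sup>n / n!\<close> for the terms on the interval \<open>(-R, R)\<close> gives uniform convergence
  there. The derivative of each term is \<open>C\<close> applied to the term before it, so the differentiated
  series converges uniformly as well, to \<open>C\<close> applied to the sum.\<close>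

lemma picard_series_solves:
  assumes C: "continuous_on UNIV C"
  shows "((\<lambda>s. \<Sum>n. picard_term C x n s) has_vector_derivative
           C t *v (\<Sum>n. picard_term C x n t)) (at t)"
proof -
  define R where "R = \<bar>t\<bar> + 1"
  define S where "S = {-R<..<R}"
  define u where "u = (\<lambda>s. \<Sum>n. picard_term C x n s)"
  obtain K where K: "K \<ge> 0" "\<And>s v. \<bar>s\<bar> \<le> R \<Longrightarrow> norm (C s *v v) \<le> K * norm v"
    using matrix_fun_bounded[OF C] by metis
  have S: "s \<in> S \<Longrightarrow> \<bar>s\<bar> \<le> R" for s by (auto simp: S_def)
  define M where "M n = norm x * ((K * R) ^ n / fact n)" for n
  have le_M: "norm (picard_term C x n s) \<le> M n" if "s \<in> S" for n s
  proof -
    have "norm (picard_term C x n s) \<le> norm x * K ^ n / fact n * \<bar>s\<bar> ^ n"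
      using picard_term_bound[OF C K] S that by blast
    also have "\<dots> \<le> norm x * K ^ n / fact n * R ^ n"
      using S[OF that] K(1) by (intro mult_left_mono power_mono) auto
    finally show ?thesis by (simp add: M_def power_mult_distrib)
  qed
  have "summable M"
    unfolding M_def using summable_exp[of "K * R"]
    by (intro summable_mult) (simp add: field_simps)
  then have ul: "uniform_limit S (\<lambda>n s. \<Sum>i<n. picard_term C x i s) u sequentially"
    unfolding u_def using le_M by (intro Weierstrass_m_test)
  define f' where "f' n s h = h *\<^sub>R (case n of 0 \<Rightarrow> 0 | Suc m \<Rightarrow> C s *v picard_term C x m s)"
    for n and s h :: real
  \<comment> \<open>The term of index 0 is constant, so partial sums of derivatives lag behind by one index.\<close>
  have sum_f': "(\<Sum>i<Suc n. f' i s h) = h *\<^sub>R (C s *v (\<Sum>i<n. picard_term C x i s))" for n s h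
    unfolding sum.lessThan_Suc_shift
    by (simp add: f'_def linear_sum[OF matrix_vector_mul_linear] scaleR_sum_right)
  have "\<exists>g. \<forall>s\<in>S. (\<lambda>n. picard_term C x n s) sums g s \<and>
          (g has_derivative (\<lambda>h. h *\<^sub>R (C s *v u s))) (at s within S)"
  proof (rule has_derivative_series[where f' = f'])
    show "convex S" by (simp add: S_def)
    show "(picard_term C x n has_derivative f' n s) (at s within S)" for n s
    proof (cases n)
      case 0 then show ?thesis by (simp add: f'_def[abs_def])
    next
      case (Suc m)
      then show ?thesis
        using picard_term_Suc(2)[OF C, of x m s]
        by (auto simp: f'_def[abs_def] has_vector_derivative_def intro: has_derivative_at_withinI)
    qed
    show "\<forall>\<^sub>F n in sequentially. \<forall>s\<in>S. \<forall>h.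
        norm ((\<Sum>i<n. f' i s h) - h *\<^sub>R (C s *v u s)) \<le> e * norm h" if "e > 0" for e
    proof -
      have "\<forall>\<^sub>F n in sequentially. \<forall>s\<in>S. dist (\<Sum>i<n. picard_term C x i s) (u s) < e / (K + 1)"
        using ul K(1) that by (intro uniform_limitD) auto
      then have "\<forall>\<^sub>F n in sequentially. \<forall>s\<in>S. \<forall>h.
        norm ((\<Sum>i<Suc n. f' i s h) - h *\<^sub>R (C s *v u s)) \<le> e * norm h"
      proof eventually_elim
        case (elim n)
        show ?case
        proof (intro ballI allI)
          fix s h assume s: "s \<in> S"
          let ?d = "(\<Sum>i<n. picard_term C x i s) - u s"
          have "norm (C s *v ?d) \<le> K * norm ?d" using K S s by auto
          also have "\<dots> \<le> (K + 1) * (e / (K + 1))"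
            using elim s K(1) that
            by (intro mult_mono) (auto simp: dist_norm less_imp_le)
          also have "\<dots> = e" using K(1) by simp
          finally have "\<bar>h\<bar> * norm (C s *v ?d) \<le> \<bar>h\<bar> * e" by (intro mult_left_mono) auto
          then show "norm ((\<Sum>i<Suc n. f' i s h) - h *\<^sub>R (C s *v u s)) \<le> e * norm h"
            unfolding sum_f' by (simp add: matrix_vector_mult_diff_distrib mult.commute
                flip: scaleR_diff_right)
        qed
      qed
      then show ?thesis by (rule eventually_sequentially_Suc[THEN iffD1])
    qed
    show "0 \<in> S" using abs_ge_zero[of t] unfolding S_def R_def by auto
    have "summable (\<lambda>n. picard_term C x n 0)"
      using \<open>summable M\<close> le_M[OF \<open>0 \<in> S\<close>] by (rule summable_comparison_test'[where N = 0])
    then show "(\<lambda>n. picard_term C x n 0) sums (\<Sum>n. picard_term C x n 0)"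
      by (rule summable_sums)
  qed
  then obtain g where g: "\<And>s. s \<in> S \<Longrightarrow> (\<lambda>n. picard_term C x n s) sums g s"
     "\<And>s. s \<in> S \<Longrightarrow> (g has_derivative (\<lambda>h. h *\<^sub>R (C s *v u s))) (at s within S)" by blast
  have gu: "g s = u s" if "s \<in> S" for s
    using g(1)[OF that] by (simp add: u_def sums_iff)
  have t: "t \<in> S" "open S" by (auto simp: S_def R_def)
  have "(g has_vector_derivative C t *v u t) (at t)"
    using g(2)[OF t(1)] unfolding has_vector_derivative_def at_within_open[OF t] .
  then have "(u has_vector_derivative C t *v u t) (at t)"
    by (rule has_vector_derivative_transform_within_open) (use t gu in auto)
  then show ?thesis by (simp add: u_def)
qed

lemma solves_exists:
  assumes C: "continuous_on UNIV C"
  shows "\<exists>u. solves C u \<and> u 0 = x"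
proof -
  have "picard_term C x n 0 = 0" if "n \<noteq> 0" for n
    using picard_term_Suc(1)[OF C] that by (cases n) auto
  then have "(\<Sum>n. picard_term C x n 0) = (\<Sum>n\<in>{0}. picard_term C x n 0)"
    by (intro suminf_finite) auto
  then show ?thesis
    using picard_series_solves[OF C, of x]
    by (intro exI[of _ "\<lambda>t. \<Sum>n. picard_term C x n t"]) (simp add: solves_def)
qed

text \<open>Existence and uniqueness identify \<^const>\<open>ivp_solution\<close> with the genuine solution; linearity in the
  initial value, again from uniqueness, is what makes the matrix represent the solution operator.\<close>

lemma transition_matrix_apply:
  assumes C: "continuous_on UNIV C" and u: "solves C u"
  shows "transition_matrix C t 0 *v u 0 = u t"
proof -
  have ivp: "ivp_solution C 0 (v 0) = v" if "solves C v" for v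
    unfolding ivp_solution_def
    by (rule the_equality) (use that solves_unique[OF C] in \<open>auto simp: solves_def\<close>)
  have comb: "ivp_solution C 0 (a *\<^sub>R x + b *\<^sub>R y) =
      (\<lambda>t. a *\<^sub>R ivp_solution C 0 x t + b *\<^sub>R ivp_solution C 0 y t)" for a b x y
  proof -
    obtain v w where v: "solves C v" "v 0 = x" and w: "solves C w" "w 0 = y"
      using solves_exists[OF C] by metis
    show ?thesis
      using ivp[OF solves_lincomb[OF v(1) w(1), of a b]] ivp[OF v(1)] ivp[OF w(1)] v(2) w(2)
      by simp
  qed
  have "linear (\<lambda>x. ivp_solution C 0 x t)"
  proof
    show "ivp_solution C 0 (x + y) t = ivp_solution C 0 x t + ivp_solution C 0 y t" for x y
      using comb[of 1 x 1 y] by simp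
    show "ivp_solution C 0 (a *\<^sub>R x) t = a *\<^sub>R ivp_solution C 0 x t" for a x
      using comb[of a x 0 x] by simp
  qed
  then show ?thesis
    unfolding transition_matrix_def by (simp add: matrix_works linear_matrix_vector_mul_eq ivp[OF u])
qed

section \<open>Positivity of cooperative flows\<close>

lemma solves_component:
  assumes "solves C u"
  shows "((\<lambda>s. u s $ i) has_real_derivative (C s *v u s) $ i) (at s)"
  unfolding has_real_derivative_iff_has_vector_derivative
  by (rule bounded_linear.has_vector_derivative[OF bounded_linear_vec_nth])
    (use assms in \<open>simp add: solves_def\<close>)

text \<open>The factor \<open>e\<^bsup>kt\<^esup>\<close> amounts to adding \<open>k\<close> to the diagonal, which makes the coefficient
  matrix entrywise nonnegative. Hence \<open>v(t) = e\<^bsup>kt\<^esup> u(t)\<close> is nondecreasing as long as it is positive, and at a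
  first time where some component reaches 0 that component would still be at least its positive
  initial value.\<close>

lemma cooperative_growth_pos:
  assumes u: "solves C u" and pos: "\<And>i. 0 < u 0 $ i"
    and off: "\<And>s i j. i \<noteq> j \<Longrightarrow> 0 \<le> C s $ i $ j"
    and diag: "\<And>s i. \<lbrakk>0 \<le> s; s \<le> T\<rbrakk> \<Longrightarrow> - k \<le> C s $ i $ i"
    and t: "0 \<le> t" "t \<le> T"
  shows "u 0 $ i \<le> exp (k * t) * u t $ i"
proof -
  define v where "v i s = exp (k * s) * u s $ i" for i s
  have du: "((\<lambda>s. u s $ i) has_real_derivative (C s *v u s) $ i) (at s)" for i s
    using solves_component[OF u] .
  have dv: "(v i has_real_derivative exp (k * s) * (k * u s $ i + (C s *v u s) $ i)) (at s)" for i s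
    unfolding v_def by (auto intro!: derivative_eq_intros du simp: algebra_simps)
  have cont: "continuous_on A (v i)" for i A
    using dv by (meson DERIV_isCont continuous_at_imp_continuous_on)
  have mono: "v i 0 \<le> v i s"
    if s: "0 \<le> s" "s \<le> T" and nn: "\<And>r j. \<lbrakk>0 \<le> r; r < s\<rbrakk> \<Longrightarrow> 0 < v j r" for i s
  proof (rule DERIV_nonneg_imp_increasing_open[OF s(1) _ cont])
    fix r assume r: "0 < r" "r < s"
    have ur: "0 < u r $ j" for j
      using nn[of r j] r by (simp add: v_def zero_less_mult_iff)
    have "(C r *v u r) $ i = C r $ i $ i * u r $ i + (\<Sum>j\<in>UNIV - {i}. C r $ i $ j * u r $ j)"
      by (rule matrix_vector_mult_split_diagonal)
    moreover have "0 \<le> (\<Sum>j\<in>UNIV - {i}. C r $ i $ j * u r $ j)"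
      using off ur by (intro sum_nonneg mult_nonneg_nonneg) (auto simp: less_imp_le)
    moreover have "0 \<le> (k + C r $ i $ i) * u r $ i"
      using diag[of r i] r s ur[of i] by (intro mult_nonneg_nonneg) auto
    ultimately have "0 \<le> k * u r $ i + (C r *v u r) $ i" by (simp add: algebra_simps)
    then show "\<exists>y. (v i has_real_derivative y) (at r) \<and> 0 \<le> y"
      using dv by (meson exp_ge_zero mult_nonneg_nonneg)
  qed
  define S where "S = {0..T} \<inter> (\<Union>j. {s. v j s \<le> 0})"
  have "S = {}"
  proof (rule ccontr)
    assume "S \<noteq> {}"
    have "compact S" unfolding S_def
      using cont by (intro compact_Int_closed closed_UN) (auto intro!: closed_Collect_le)
    then obtain s where s: "s \<in> S" "\<And>r. r \<in> S \<Longrightarrow> s \<le> r"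
      using compact_attains_inf[OF _ \<open>S \<noteq> {}\<close>] by blast
    then obtain j where j: "v j s \<le> 0" "0 \<le> s" "s \<le> T" by (auto simp: S_def)
    have "v j 0 \<le> v j s"
    proof (rule mono[OF j(2,3)])
      fix r i assume "0 \<le> r" "r < s"
      then have "r \<notin> S" "r \<in> {0..T}" using s(2)[of r] j by auto
      then show "0 < v i r" by (auto simp: S_def not_le)
    qed
    with j(1) pos[of j] show False by (simp add: v_def)
  qed
  then have no_zero: "r \<notin> S" for r by simp
  have "0 < v j r" if "0 \<le> r" "r \<le> T" for j r
    using no_zero[of r] that by (auto simp: S_def not_le)
  then have "v i 0 \<le> v i t" using mono[OF t] t(2) by auto
  then show ?thesis by (simp add: v_def)
qed

text \<open>The case of nonnegative initial values follows from the strictly positive one by adding a small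
  multiple of the solution that starts at \<open>(1, \<dots>, 1)\<close>.\<close>

lemma cooperative_growth:
  assumes C: "continuous_on UNIV C" and u: "solves C u" and nonneg: "\<And>i. 0 \<le> u 0 $ i"
    and off: "\<And>s i j. i \<noteq> j \<Longrightarrow> 0 \<le> C s $ i $ j"
    and diag: "\<And>s i. \<lbrakk>0 \<le> s; s \<le> T\<rbrakk> \<Longrightarrow> - k \<le> C s $ i $ i"
    and t: "0 \<le> t" "t \<le> T"
  shows "u 0 $ i \<le> exp (k * t) * u t $ i"
proof -
  obtain w where w: "solves C w" "w 0 = (\<chi> i. 1)" using solves_exists[OF C] by metis
  have "1 \<le> exp (k * t) * w t $ i" (is "1 \<le> ?b")
    using cooperative_growth_pos[OF w(1) _ off diag t, of i] w(2) by simp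
  show ?thesis
  proof (rule field_le_epsilon)
    fix e :: real assume e: "0 < e"
    define d where "d = e / ?b"
    have d: "0 < d" "d * ?b = e" using e \<open>1 \<le> ?b\<close> by (auto simp: d_def)
    have "(1 *\<^sub>R u 0 + d *\<^sub>R w 0) $ i \<le> exp (k * t) * (1 *\<^sub>R u t + d *\<^sub>R w t) $ i"
      by (rule cooperative_growth_pos[OF solves_lincomb[OF u w(1)] _ off diag t])
        (use nonneg d w(2) in \<open>auto intro: add_nonneg_pos\<close>)
    then have "u 0 $ i + d \<le> exp (k * t) * u t $ i + d * ?b"
      using w(2) by (simp add: algebra_simps)
    with d show "u 0 $ i \<le> exp (k * t) * u t $ i + e" by simp
  qed
qed

text \<open>A component \<open>j\<close> that starts positive stays positive, and through \<open>c\<^sub>i\<^sub>j > 0\<close> it feeds every other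
  component \<open>i\<close>: the derivative of \<open>e\<^bsup>kt\<^esup> u\<^sub>i(t)\<close> is strictly positive.\<close>

lemma strongly_cooperative_positive:
  assumes C: "continuous_on UNIV C" and u: "solves C u"
    and nonneg: "\<And>i. 0 \<le> u 0 $ i" and j: "0 < u 0 $ j"
    and off: "\<And>s i j. i \<noteq> j \<Longrightarrow> 0 < C s $ i $ j"
    and t: "0 < t"
  shows "0 < u t $ i"
proof -
  obtain k where k: "\<And>s v. \<bar>s\<bar> \<le> t \<Longrightarrow> norm (C s *v v) \<le> k * norm v"
    using matrix_fun_bounded[OF C] by metis
  have diag: "- k \<le> C s $ i $ i" if "0 \<le> s" "s \<le> t" for s i
  proof -
    have "\<bar>C s $ i $ i\<bar> = \<bar>(C s *v axis i 1) $ i\<bar>"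
      by (simp add: matrix_vector_mult_basis column_def)
    also have "\<dots> \<le> norm (C s *v axis i 1)" by (rule component_le_norm_cart)
    also have "\<dots> \<le> k" using k[of s "axis i 1"] that by (simp add: norm_axis_1)
    finally show ?thesis by simp
  qed
  have grow: "u 0 $ i \<le> exp (k * s) * u s $ i" if "0 \<le> s" "s \<le> t" for s i
    using cooperative_growth[OF C u nonneg less_imp_le[OF off] diag that] .
  have u_nonneg: "0 \<le> u s $ i" if "0 \<le> s" "s \<le> t" for s i
    using grow[OF that] nonneg by (meson exp_gt_zero order_trans zero_le_mult_iff not_less)
  have u_pos: "0 < u s $ i" if "0 \<le> s" "s \<le> t" "0 < u 0 $ i" for s i
    using grow[OF that(1,2), of i] that(3) exp_gt_zero[of "k * s"]
    by (metis less_le_trans zero_less_mult_pos)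
  show ?thesis
  proof (cases "i = j")
    case True then show ?thesis using u_pos[of t j] j t by simp
  next
    case False
    have "exp (k * 0) * u 0 $ i < exp (k * t) * u t $ i"
    proof (rule DERIV_pos_imp_increasing_open[OF t])
      fix s assume s: "0 < s" "s < t"
      have du: "((\<lambda>s. u s $ i) has_real_derivative (C s *v u s) $ i) (at s)"
        using solves_component[OF u] .
      have "(C s *v u s) $ i = C s $ i $ i * u s $ i + (\<Sum>j\<in>UNIV - {i}. C s $ i $ j * u s $ j)"
        by (rule matrix_vector_mult_split_diagonal)
      moreover have "0 < (\<Sum>j\<in>UNIV - {i}. C s $ i $ j * u s $ j)"
        by (rule sum_pos2[of _ j]) (use s u_nonneg u_pos[of s j] j False off in
            \<open>auto intro!: mult_nonneg_nonneg less_imp_le[OF off]\<close>)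
      moreover have "0 \<le> (k + C s $ i $ i) * u s $ i"
        using diag[of s i] u_nonneg[of s i] s by (intro mult_nonneg_nonneg) auto
      ultimately have "0 < k * u s $ i + (C s *v u s) $ i" by (simp add: algebra_simps)
      moreover have "((\<lambda>s. exp (k * s) * u s $ i) has_real_derivative
          exp (k * s) * (k * u s $ i + (C s *v u s) $ i)) (at s)"
        by (auto intro!: derivative_eq_intros du simp: algebra_simps)
      ultimately show "\<exists>y. ((\<lambda>s. exp (k * s) * u s $ i) has_real_derivative y) (at s) \<and> 0 < y"
        by (meson exp_gt_zero mult_pos_pos)
    next
      have "continuous_on {0..t} u"
        using u by (meson solves_def has_vector_derivative_continuous continuous_at_imp_continuous_on)
      then show "continuous_on {0..t} (\<lambda>s. exp (k * s) * u s $ i)"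
        by (intro continuous_intros)
    qed
    then have "0 < exp (k * t) * u t $ i"
      using nonneg[of i] by simp
    then show ?thesis by (simp add: zero_less_mult_iff)
  qed
qed

lemma transition_matrix_positive:
  assumes C: "continuous_on UNIV C" and off: "\<And>s i j. i \<noteq> j \<Longrightarrow> 0 < C s $ i $ j" and t: "0 < t"
  shows "0 < transition_matrix C t 0 $ i $ j"
proof -
  obtain u where u: "solves C u" "u 0 = axis j 1" using solves_exists[OF C] by metis
  have "0 < u t $ i"
    by (rule strongly_cooperative_positive[OF C u(1) _ _ off t, of j])
      (simp_all add: u(2) axis_def)
  moreover have "transition_matrix C t 0 $ i $ j = u t $ i"
    using transition_matrix_apply[OF C u(1), of t]
    by (simp add: u(2) matrix_vector_mult_basis column_def vec_eq_iff)
  ultimately show ?thesis by simp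
qed

section \<open>Averaging the logarithm of a positive solution\<close>

text \<open>Jensen's inequality for the exponential: integrate its tangent at the mean value of \<open>w\<close>,
  whose linear part averages to zero.\<close>

lemma exp_average_le:
  fixes w :: "real \<Rightarrow> real"
  assumes T: "0 < T" and w: "continuous_on {0..T} w"
  shows "T * exp ((1 / T) * integral {0..T} w) \<le> integral {0..T} (\<lambda>t. exp (w t))"
proof -
  define m where "m = (1 / T) * integral {0..T} w"
  have wint: "w integrable_on {0..T}" using w by (rule integrable_continuous_real)
  have const: "((\<lambda>t. c) has_integral T * c) {0..T}" for c :: real
    using has_integral_const_real[of c 0 T] T by simp
  have "((\<lambda>t. exp m * (1 + (w t - m))) has_integral
      exp m * (T * 1 + (integral {0..T} w - T * m))) {0..T}"
    by (intro has_integral_mult_right has_integral_add has_integral_diff integrable_integral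
        wint const)
  then have "((\<lambda>t. exp m * (1 + (w t - m))) has_integral T * exp m) {0..T}"
    using T by (simp add: m_def mult.commute)
  moreover have "((\<lambda>t. exp (w t)) has_integral integral {0..T} (\<lambda>t. exp (w t))) {0..T}"
    using w by (intro integrable_integral integrable_continuous_real continuous_intros)
  moreover have "exp m * (1 + (w t - m)) \<le> exp (w t)" for t
  proof -
    have "exp m * (1 + (w t - m)) \<le> exp m * exp (w t - m)"
      by (intro mult_left_mono exp_ge_add_one_self) auto
    then show ?thesis by (simp flip: exp_add)
  qed
  ultimately show ?thesis unfolding m_def[symmetric] by (rule has_integral_le)
qed

text \<open>Write \<open>w\<^sub>i = ln u\<^sub>i\<close>. Dividing the \<open>i\<close>-th equation by \<open>u\<^sub>i\<close> gives
  \<open>w\<^sub>i' = c\<^sub>i\<^sub>i(t) + (\<Sum>j\<noteq>i. c\<^sub>i\<^sub>j exp (w\<^sub>j - w\<^sub>i))\<close>. Over \<open>[0, T]\<close> the left-hand side integrates to \<open>ln r\<close>.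
  The constants \<open>c\<^sub>i\<^sub>j\<close> come out of the integral, so that Jensen's inequality applies to each
  exponential separately and produces the quotients \<open>z\<^sub>j / z\<^sub>i\<close>.\<close>

lemma averaged_log_supersolution:
  fixes C :: "real \<Rightarrow> real^'n^'n" and T :: real
  assumes T: "T > 0" and C: "continuous_on UNIV C"
    and off: "\<And>t i j. i \<noteq> j \<Longrightarrow> C t $ i $ j > 0"
    and const: "\<And>s t i j. i \<noteq> j \<Longrightarrow> C s $ i $ j = C t $ i $ j"
    and u: "solves C u" and pos: "\<And>t i. \<lbrakk>0 \<le> t; t \<le> T\<rbrakk> \<Longrightarrow> 0 < u t $ i"
    and r: "0 < r" and uT: "u T = r *s u 0"
    and z: "z = (\<chi> i. exp ((1 / T) * integral {0..T} (\<lambda>t. ln (u t $ i))))"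
  shows "(time_average C T *v z) $ i \<le> (ln r / T) * z $ i"
proof -
  define w where "w i t = ln (u t $ i)" for i t
  define q where "q j t = exp (w j t - w i t)" for j t
  have w_cont: "continuous_on {0..T} (w j)" for j
  proof -
    have "continuous_on {0..T} u"
      using u by (meson solves_def has_vector_derivative_continuous continuous_at_imp_continuous_on)
    then show ?thesis unfolding w_def
      using pos by (intro continuous_intros) (force simp: less_le)+
  qed
  have q_int: "q j integrable_on {0..T}" for j
    unfolding q_def by (intro integrable_continuous_real continuous_intros w_cont)
  have c_int: "(\<lambda>t. C t $ i $ i) integrable_on {0..T}"
    by (intro integrable_continuous_real continuous_intros continuous_on_subset[OF C]) auto
  have dw: "(w i has_vector_derivative
      C t $ i $ i + (\<Sum>j\<in>UNIV - {i}. C 0 $ i $ j * q j t)) (at t within {0..T})"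
    if t: "t \<in> {0..T}" for t
  proof -
    have p: "0 < u t $ j" for j using pos t by auto
    have "(w i has_real_derivative (C t *v u t) $ i / u t $ i) (at t)"
      unfolding w_def using p[of i] by (auto intro!: derivative_eq_intros solves_component[OF u])
    moreover have "(C t *v u t) $ i / u t $ i = C t $ i $ i + (\<Sum>j\<in>UNIV - {i}. C 0 $ i $ j * q j t)"
    proof -
      have "C t $ i $ j * u t $ j / u t $ i = C 0 $ i $ j * q j t" if "j \<noteq> i" for j
        using that const[of i j t 0] p by (simp add: q_def w_def exp_diff)
      then show ?thesis
        using p[of i] unfolding matrix_vector_mult_split_diagonal
        by (simp add: add_divide_distrib sum_divide_distrib)
    qed
    ultimately show ?thesis
      by (simp add: has_real_derivative_iff_has_vector_derivative has_vector_derivative_at_within)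
  qed
  have ftc: "((\<lambda>t. C t $ i $ i + (\<Sum>j\<in>UNIV - {i}. C 0 $ i $ j * q j t)) has_integral (w i T - w i 0)) {0..T}"
    using T by (intro fundamental_theorem_of_calculus dw) auto
  have termwise: "((\<lambda>t. C t $ i $ i + (\<Sum>j\<in>UNIV - {i}. C 0 $ i $ j * q j t)) has_integral
     (integral {0..T} (\<lambda>t. C t $ i $ i) + (\<Sum>j\<in>UNIV - {i}. C 0 $ i $ j * integral {0..T} (q j)))) {0..T}"
    by (intro has_integral_add has_integral_sum has_integral_mult_right integrable_integral c_int q_int) auto
  have wT: "w i T - w i 0 = ln r"
    using pos[of 0 i] T r by (simp add: w_def uT ln_mult)
  have eq: "ln r = integral {0..T} (\<lambda>t. C t $ i $ i) +
      (\<Sum>j\<in>UNIV - {i}. C 0 $ i $ j * integral {0..T} (q j))"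
    using has_integral_unique[OF ftc termwise] unfolding wT .
  have zpos: "0 < z $ j" for j by (simp add: z)
  \<comment> \<open>The exponential of an averaged difference is a quotient of entries of \<open>z\<close>.\<close>
  have jensen: "T * (z $ j / z $ i) \<le> integral {0..T} (q j)" for j
  proof -
    have "(1 / T) * integral {0..T} (\<lambda>t. w j t - w i t) =
      (1 / T) * integral {0..T} (w j) - (1 / T) * integral {0..T} (w i)"
      using w_cont by (simp add: integral_diff integrable_continuous_real diff_divide_distrib)
    then have "z $ j / z $ i = exp ((1 / T) * integral {0..T} (\<lambda>t. w j t - w i t))"
      by (simp add: z w_def[abs_def] exp_diff)
    then show ?thesis
      using exp_average_le[OF T, of "\<lambda>t. w j t - w i t"] w_cont
      by (simp add: q_def[abs_def] continuous_on_diff)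
  qed
  have "(time_average C T *v z) $ i = (1 / T) * integral {0..T} (\<lambda>t. C t $ i $ i) * z $ i +
      (\<Sum>j\<in>UNIV - {i}. C 0 $ i $ j * z $ j)"
    unfolding matrix_vector_mult_split_diagonal by (simp add: time_average_def)
  also have "(\<Sum>j\<in>UNIV - {i}. C 0 $ i $ j * z $ j) \<le>
      (\<Sum>j\<in>UNIV - {i}. C 0 $ i $ j * ((1 / T) * integral {0..T} (q j) * z $ i))"
  proof (intro sum_mono mult_left_mono)
    fix j assume "j \<in> UNIV - {i}"
    then show "0 \<le> C 0 $ i $ j" using off[of i j 0] by auto
    show "z $ j \<le> (1 / T) * integral {0..T} (q j) * z $ i"
      using jensen[of j] T zpos[of i] by (simp add: field_simps)
  qed
  also have "(1 / T) * integral {0..T} (\<lambda>t. C t $ i $ i) * z $ i + \<dots> = (ln r / T) * z $ i"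
    unfolding eq by (simp add: add_divide_distrib distrib_left sum_distrib_left sum_divide_distrib mult_ac)
  finally show ?thesis by simp
qed

theorem mainTheorem1:
  fixes C :: "real \<Rightarrow> real^'n^'n" and T :: real
  assumes "T > 0"
    and "continuous_on UNIV C"
    and "\<And>t. C (t + T) = C t"
    and "\<And>t i j. i \<noteq> j \<Longrightarrow> C t $ i $ j > 0"
    and "\<And>s t i j. i \<noteq> j \<Longrightarrow> C s $ i $ j = C t $ i $ j"
  shows "principal_lyapunov_exponent C T \<ge> dominant_eigenvalue (time_average C T)"
proof -
  note T = assms(1) and C = assms(2) and off = assms(4) and const = assms(5)
  let ?U = "transition_matrix C T 0"
  have U: "0 < ?U $ i $ j" for i j
    using transition_matrix_positive[OF C off T] .
  obtain x r where x: "\<And>i. 0 < x $ i" and r: "0 < r" and Ux: "?U *v x = r *s x"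
    using perron_vector[of ?U] U by metis
  obtain u where u: "solves C u" "u 0 = x" using solves_exists[OF C] by metis
  have uT: "u T = r *s u 0"
    using transition_matrix_apply[OF C u(1), of T] Ux by (simp add: u(2))
  have pos: "0 < u t $ i" if "0 \<le> t" "t \<le> T" for t i
  proof (cases "t = 0")
    case False
    then show ?thesis
      using strongly_cooperative_positive[OF C u(1) _ _ off, of i t i] x that u(2)
      by (simp add: less_imp_le)
  qed (use x u in simp)
  define z :: "real^'n" where "z = (\<chi> i. exp ((1 / T) * integral {0..T} (\<lambda>t. ln (u t $ i))))"
  have "dominant_eigenvalue (time_average C T) \<le> ln r / T"
  proof (rule dominant_eigenvalue_le)
    show "0 < time_average C T $ i $ j" if "i \<noteq> j" for i j
      using off that by (simp add: time_average_def)
    show "0 < z $ i" for i by (simp add: z_def)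
    show "(time_average C T *v z) $ i \<le> (ln r / T) * z $ i" for i
      using averaged_log_supersolution[OF T C off const u(1) pos r uT z_def] .
  qed
  also have "ln r / T \<le> principal_lyapunov_exponent C T"
  proof -
    have "r \<le> spectral_radius ?U"
      using le_spectral_radius[OF less_imp_le[OF U] x Ux] .
    then show ?thesis
      using r T unfolding principal_lyapunov_exponent_def
      by (intro divide_right_mono ln_mono) auto
  qed
  finally show ?thesis .
qed

end
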